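(* Let $P_1(x_1)$ and $P_2(x_2)$ be polynomials and let $n\in\mathbb{N}_0$. Then, wherever $P_2(x_2)\ne 0$ and $P_1^2(x_1)-4P_2(x_2)\neq 0$ (so that the right-hand side is defined), $$\mathbb{Y}_n\left(P_1(x_1),P_2(x_2)\right)=\frac{2^{n-1}\left(P_2(x_2)\right)^n}{\sqrt{P_1^2(x_1)-4P_2(x_2)}}\left(\frac{P_1(x_1)+\sqrt{P_1^2(x_1)-4P_2(x_2)}}{\left(-P_1(x_1)+\sqrt{P_1^2(x_1)-4P_2(x_2)}\right)^n}\right)-\frac{2^{n-1}\left(P_2(x_2)\right)^n}{\sqrt{P_1^2(x_1)-4P_2(x_2)}}\left(\frac{P_1(x_1)-\sqrt{P_1^2(x_1)-4P_2(x_2)}}{\left(-P_1(x_1)-\sqrt{P_1^2(x_1)-4P_2(x_2)}\right)^n}\right).$$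
   Context: $\mathbb{N}_0=\{0,1,2,\ldots\}$. $P_1(x_1)$ and $P_2(x_2)$ are arbitrary polynomials (say with complex coefficients, evaluated at complex $x_1,x_2$). The polynomials $\mathbb{Y}_n(P_1(x_1),P_2(x_2))$, $n\ge 0$, are defined by the power series expansion in $w$ $$\frac{1}{1+P_1(x_1)w+P_2(x_2)w^2}=\sum_{n=0}^{\infty}\mathbb{Y}_n\left(P_1(x_1),P_2(x_2)\right)w^n.$$ The symbol $\sqrt{P_1^2(x_1)-4P_2(x_2)}$ denotes one fixed square root, the same in every occurrence. *)

theory Defs
  imports Complex_Main "HOL-Computational_Algebra.Computational_Algebra"
begin

text \<open>
  \<open>Y_poly n a b\<close> is the coefficient of \<open>w^n\<close> in the power series expansion of
  \<open>1 / (1 + a w + b w^2)\<close>, taken in the ring of formal power series over the complex numbers.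
  The denominator has constant term 1, so it is a unit of that ring and \<open>/\<close> is division by a unit.
\<close>

definition Y_poly :: "nat \<Rightarrow> complex \<Rightarrow> complex \<Rightarrow> complex" where
  "Y_poly n a b = fps_nth (1 / (1 + fps_const a * fps_X + fps_const b * fps_X ^ 2)) n"

end

theory Submission
  imports Defs
begin

text \<open>
  Put \<open>u = (- a - s) / 2\<close> and \<open>v = (- a + s) / 2\<close> with \<open>s\<^sup>2 = a\<^sup>2 - 4 b\<close>. Then \<open>u + v = - a\<close> and
  \<open>u v = b\<close>, so the denominator factors as \<open>1 + a w + b w\<^sup>2 = (1 - u w) (1 - v w)\<close>, and partial
  fractions give the coefficients \<open>(v\<^sup>n\<^sup>+\<^sup>1 - u\<^sup>n\<^sup>+\<^sup>1) / (v - u)\<close>, where \<open>v - u = s\<close>.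
  The right-hand side of the theorem is this quotient in disguise: since \<open>u v = b\<close>, the factor
  \<open>b\<^sup>n / (- a + s)\<^sup>n\<close> equals \<open>(u / 2)\<^sup>n\<close>, and \<open>a + s = - 2 u\<close>; likewise with \<open>u\<close>, \<open>s\<close> replaced by
  \<open>v\<close>, \<open>- s\<close>.
\<close>

lemma fps_geometric_mult:
  fixes c :: "'a :: comm_ring_1"
  shows "(1 - fps_const c * fps_X) * Abs_fps (\<lambda>n. c ^ n) = 1"
proof (rule fps_ext)
  fix n show "fps_nth ((1 - fps_const c * fps_X) * Abs_fps (\<lambda>n. c ^ n)) n = fps_nth 1 n"
    by (cases n) (simp_all add: left_diff_distrib mult.assoc)
qed

text \<open>
  Partial fractions, multiplied through by \<open>v - u\<close>: with \<open>G\<^sub>c = 1 / (1 - c w)\<close> one has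
  \<open>(v - u) G\<^sub>u G\<^sub>v = v G\<^sub>v - u G\<^sub>u\<close>, because \<open>v - u = v (1 - u w) - u (1 - v w)\<close>.
\<close>

lemma fps_nth_inverse_two_linear_factors:
  fixes u v :: "'a :: field"
  shows "(v - u) * fps_nth (1 / ((1 - fps_const u * fps_X) * (1 - fps_const v * fps_X))) n
    = v ^ Suc n - u ^ Suc n"
proof -
  define G :: "'a \<Rightarrow> 'a fps" where "G c = Abs_fps (\<lambda>n. c ^ n)" for c
  define L :: "'a \<Rightarrow> 'a fps" where "L c = 1 - fps_const c * fps_X" for c
  have LG: "L c * G c = 1" for c
    unfolding L_def G_def by (rule fps_geometric_mult)
  have "(G u * G v) * (L u * L v) = (L u * G u) * (L v * G v)"
    by (simp only: mult_ac)
  then have prod1: "(G u * G v) * (L u * L v) = 1"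
    by (simp add: LG)
  then have "L u * L v \<noteq> 0" by auto
  then have inv: "1 / (L u * L v) = G u * G v"
    using prod1 by (metis nonzero_mult_div_cancel_right)
  have "fps_const (v - u) = fps_const v * L u - fps_const u * L v"
    by (simp add: L_def algebra_simps flip: fps_const_sub)
  then have "fps_const (v - u) * (G u * G v)
      = (fps_const v * L u - fps_const u * L v) * (G u * G v)"
    by simp
  also have "\<dots> = fps_const v * G v * (L u * G u) - fps_const u * G u * (L v * G v)"
    by (simp only: left_diff_distrib right_diff_distrib mult_ac)
  finally have "fps_const (v - u) * (1 / (L u * L v)) = fps_const v * G v - fps_const u * G u"
    by (simp add: LG inv)
  then have "fps_nth (fps_const (v - u) * (1 / (L u * L v))) n
      = fps_nth (fps_const v * G v - fps_const u * G u) n"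
    by simp
  then show ?thesis
    by (simp only: L_def G_def fps_mult_left_const_nth fps_sub_nth fps_nth_Abs_fps power_Suc)
qed

text \<open>
  Since \<open>(- a + s) (- a - s) = 4 b\<close>, dividing \<open>b\<close> by one conjugate factor leaves a quarter of the
  other, so no negative powers remain. Replacing \<open>s\<close> by \<open>- s\<close> gives the second term of the closed
  form, including its minus sign, which comes from the division by \<open>- s\<close>.
\<close>

lemma closed_form_term:
  fixes a b s :: complex
  assumes "b \<noteq> 0" and "s\<^sup>2 = a\<^sup>2 - 4 * b"
  shows "2 powi (int n - 1) * b ^ n / s * ((a + s) / (- a + s) ^ n) = - (((- a - s) / 2) ^ Suc n / s)"
proof -
  have prod: "(- a + s) * (- a - s) = 4 * b"
    using assms(2) by (simp add: algebra_simps power2_eq_square)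
  then have nz: "- a + s \<noteq> 0" using assms(1) by auto
  have "2 * b / (- a + s) = (- a - s) / 2"
    using prod nz by (simp add: divide_eq_eq) (simp add: algebra_simps)
  then have pow: "2 ^ n * b ^ n / (- a + s) ^ n = ((- a - s) / 2) ^ n"
    by (metis power_divide power_mult_distrib)
  have "2 powi (int n - 1) = (2 ^ n / 2 :: complex)"
    by (simp add: power_int_diff)
  then have "2 powi (int n - 1) * b ^ n / s * ((a + s) / (- a + s) ^ n)
      = (2 ^ n * b ^ n / (- a + s) ^ n) * ((a + s) / 2) / s"
    by (simp only:) (simp add: mult_ac)
  also have "\<dots> = ((- a - s) / 2) ^ n * (- ((- a - s) / 2)) / s"
  proof -
    have "(a + s) / 2 = - ((- a - s) / 2)"
      by (simp add: field_simps)
    then show ?thesis unfolding pow by (simp only:)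
  qed
  finally show ?thesis by simp
qed

theorem theorem12:
  fixes P1 P2 :: "complex poly" and x1 x2 s :: complex and n :: nat
  assumes "poly P2 x2 \<noteq> 0"
    and "(poly P1 x1)\<^sup>2 - 4 * poly P2 x2 \<noteq> 0"
    and "s\<^sup>2 = (poly P1 x1)\<^sup>2 - 4 * poly P2 x2"
  shows "Y_poly n (poly P1 x1) (poly P2 x2) =
      2 powi (int n - 1) * (poly P2 x2) ^ n / s *
        ((poly P1 x1 + s) / (- poly P1 x1 + s) ^ n)
    - 2 powi (int n - 1) * (poly P2 x2) ^ n / s *
        ((poly P1 x1 - s) / (- poly P1 x1 - s) ^ n)"
proof -
  define a where "a = poly P1 x1"
  define b where "b = poly P2 x2"
  define u where "u = (- a - s) / 2"
  define v where "v = (- a + s) / 2"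
  have b: "b \<noteq> 0" and s2: "s\<^sup>2 = a\<^sup>2 - 4 * b" and s: "s \<noteq> 0"
    using assms by (auto simp: a_def b_def)
  have diff: "v - u = s" and sum: "a = - (u + v)"
    by (simp_all add: u_def v_def field_simps)
  have prod: "b = u * v"
    using s2 by (simp add: u_def v_def field_simps power2_eq_square)
  have "1 + fps_const a * fps_X + fps_const b * fps_X ^ 2
      = (1 - fps_const u * fps_X) * (1 - fps_const v * fps_X)"
    unfolding sum prod
    by (simp add: algebra_simps power2_eq_square flip: fps_const_add fps_const_mult fps_const_neg)
  then have "s * Y_poly n a b = v ^ Suc n - u ^ Suc n"
    unfolding Y_poly_def using fps_nth_inverse_two_linear_factors[of v u n] by (simp only: diff)
  then have Y: "Y_poly n a b = v ^ Suc n / s - u ^ Suc n / s"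
    using s by (simp add: field_simps)
  have plus: "2 powi (int n - 1) * b ^ n / s * ((a + s) / (- a + s) ^ n) = - (u ^ Suc n / s)"
    unfolding u_def by (rule closed_form_term[OF b s2])
  have minus: "2 powi (int n - 1) * b ^ n / s * ((a - s) / (- a - s) ^ n) = - (v ^ Suc n / s)"
  proof -
    have "- (2 powi (int n - 1) * b ^ n / s * ((a - s) / (- a - s) ^ n)) = v ^ Suc n / s"
      using closed_form_term[of b "- s" a n] b s2 by (simp add: v_def)
    then show ?thesis by (metis minus_minus)
  qed
  show ?thesis
    unfolding a_def[symmetric] b_def[symmetric] plus minus by (simp add: Y)
qed

end
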